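(* Let $\Phi\subset N_{\mathbb R}$ be an admissible domain. If $t>0$ and $\Phi(t)$ has non-empty interior, then $\Phi(t)$ is a canonical tropical domain. Furthermore, if $t'>t>0$ and $\Phi(t')$ has non-empty interior, then $\operatorname{Fan}(\Phi(t'))\subset\operatorname{Fan}(\Phi(t))$.
   Context: $N\cong\mathbb Z^2$ is a rank two lattice, $N_{\mathbb R}=N\otimes\mathbb R$, $M=\operatorname{Hom}(N,\mathbb Z)$, $M_{\mathbb R}=M\otimes\mathbb R$. A half-plane with rational slope is $H=\{p\in N_{\mathbb R}:\lambda(p)\ge c\}$ with $c\in\mathbb R$ and $\lambda\in M$ primitive (the slope of $H$); for $t\in\mathbb R$, $H(t)=\{p:\lambda(p)\ge c+t\}$. For convex $\Phi$, $\mathcal H_\Phi$ is the set of rational-slope half-planes $H$ with $H\supset\Phi$ and $\partial H\cap\partial\Phi\neq\emptyset$. $\Phi$ is admissible if it is closed, convex and $\mathcal H_\Phi\ne\emptyset$; then $\Phi(t)=\bigcap_{H\in\mathcal H_\Phi}H(t)$ for $t\ge0$. For $t>0$ the set $\Phi(t)$ is a polygonal domain with rational slopes, i.e. a convex set whose intersection with any bounded region coincides there with the intersection of finitely many rational-slope half-planes; its boundary is a broken line consisting of sides. When it has non-empty interior, $\operatorname{Fan}(\Phi(t))\subset M_{\mathbb R}$ denotes the union of the rays from the origin generated by the slopes $\lambda\in M$ of the support half-planes whose boundary lines contain the sides of $\Phi(t)$. A rational cone (angle) generated by primitive non-collinear integer vectors $v,w$ has determinant $|v\wedge w|$ (absolute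 value of the determinant of $v,w$ in a lattice basis), width equal to the largest integer $l$ such that $(v-w)/l$ is a lattice vector, and height equal to determinant divided by width. It is an $A_{d-1}$-cone if it has height 1 and width $d$. An angle $\Sigma\subset N_{\mathbb R}$ is canonical if its dual cone $\Sigma^*=\{q\in M_{\mathbb R}: q(p)\ge0\ \forall p\in\Sigma\}$ is an $A_{d-1}$-cone with respect to $M$ for some $d\ge1$. A canonical tropical domain is a polygonal domain with rational slopes and non-empty interior which, near each of its vertices, coincides with a translate of a canonical angle (equivalently, the cone of $M_{\mathbb R}$ generated by the slopes of the two sides adjacent to any vertex is an $A_{d-1}$-cone for some $d\geq 1$). *)

theory Defs
  imports "HOL-Analysis.Analysis"
begin

text \<open>
  A basis of \<open>N\<close> is fixed, and the dual basis of \<open>M = Hom(N, \<int>)\<close>. Thus \<open>N\<close> and \<open>M\<close> are both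
  \<^typ>\<open>int \<times> int\<close>, the real spaces \<open>N\<^sub>\<real>\<close> and \<open>M\<^sub>\<real>\<close> are both \<^typ>\<open>real \<times> real\<close>, and the pairing of
  \<open>M\<^sub>\<real>\<close> with \<open>N\<^sub>\<real>\<close> is the standard inner product.
\<close>

type_synonym lattice = "int \<times> int"
type_synonym plane = "real \<times> real"

definition of_lattice :: "lattice \<Rightarrow> plane" where
  "of_lattice v = (of_int (fst v), of_int (snd v))"

definition primitive :: "lattice \<Rightarrow> bool" where
  "primitive v \<longleftrightarrow> coprime (fst v) (snd v)"

definition wedge :: "lattice \<Rightarrow> lattice \<Rightarrow> int" where
  "wedge v w = fst v * snd w - snd v * fst w"

text \<open>
  A half-plane with rational slope is represented by the pair of its primitive slope \<open>l\<close> and the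
  constant \<open>c\<close>; both are determined by the half-plane. In these terms \<open>H(t)\<close> is
  \<open>halfplane l (c + t)\<close>.
\<close>

definition halfplane :: "lattice \<Rightarrow> real \<Rightarrow> plane set" where
  "halfplane l c = {p. of_lattice l \<bullet> p \<ge> c}"

definition support_halfplanes :: "plane set \<Rightarrow> (lattice \<times> real) set" where
  "support_halfplanes \<Phi> =
     {(l, c). primitive l \<and> \<Phi> \<subseteq> halfplane l c \<and> frontier (halfplane l c) \<inter> frontier \<Phi> \<noteq> {}}"

definition admissible :: "plane set \<Rightarrow> bool" where
  "admissible \<Phi> \<longleftrightarrow> closed \<Phi> \<and> convex \<Phi> \<and> support_halfplanes \<Phi> \<noteq> {}"

definition shrink :: "plane set \<Rightarrow> real \<Rightarrow> plane set" where
  "shrink \<Phi> t = (\<Inter>(l, c) \<in> support_halfplanes \<Phi>. halfplane l (c + t))"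

definition polygonal_domain :: "plane set \<Rightarrow> bool" where
  "polygonal_domain P \<longleftrightarrow> convex P \<and>
     (\<forall>B. bounded B \<longrightarrow>
        (\<exists>F. finite F \<and> (\<forall>(l, c) \<in> F. primitive l) \<and> P \<inter> B = (\<Inter>(l, c) \<in> F. halfplane l c) \<inter> B))"

definition ray :: "lattice \<Rightarrow> plane set" where
  "ray v = {r *\<^sub>R of_lattice v | r. r \<ge> 0}"

text \<open>The sides of a domain with non-empty interior are its one-dimensional faces.\<close>

definition Fan :: "plane set \<Rightarrow> plane set" where
  "Fan P = \<Union> {ray l | l c S. (l, c) \<in> support_halfplanes P \<and> S edge_of P \<and>
                              S \<subseteq> frontier (halfplane l c)}"

definition angle :: "lattice \<Rightarrow> lattice \<Rightarrow> plane set" where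
  "angle v w = {a *\<^sub>R of_lattice v + b *\<^sub>R of_lattice w | a b. a \<ge> 0 \<and> b \<ge> 0}"

definition angle_generators :: "lattice \<Rightarrow> lattice \<Rightarrow> bool" where
  "angle_generators v w \<longleftrightarrow> primitive v \<and> primitive w \<and> wedge v w \<noteq> 0"

definition determinant :: "lattice \<Rightarrow> lattice \<Rightarrow> int" where
  "determinant v w = \<bar>wedge v w\<bar>"

definition width :: "lattice \<Rightarrow> lattice \<Rightarrow> int" where
  "width v w = (GREATEST l. l dvd fst v - fst w \<and> l dvd snd v - snd w)"

definition height :: "lattice \<Rightarrow> lattice \<Rightarrow> real" where
  "height v w = of_int (determinant v w) / of_int (width v w)"

text \<open>
  The primitive generators of a rational cone are unique up to order, and width and height are
  symmetric in the generators. The parameter \<open>d\<close> is the width, so \<open>A_cone d\<close> describes the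
  \<open>A\<close>-cones of index \<open>d - 1\<close>.
\<close>

definition A_cone :: "nat \<Rightarrow> plane set \<Rightarrow> bool" where
  "A_cone d C \<longleftrightarrow>
     (\<exists>v w. angle_generators v w \<and> C = angle v w \<and> height v w = 1 \<and> width v w = int d)"

definition dual_cone :: "plane set \<Rightarrow> plane set" where
  "dual_cone \<Sigma> = {q. \<forall>p\<in>\<Sigma>. q \<bullet> p \<ge> 0}"

definition canonical_angle :: "plane set \<Rightarrow> bool" where
  "canonical_angle \<Sigma> \<longleftrightarrow>
     (\<exists>v w. angle_generators v w \<and> \<Sigma> = angle v w) \<and> (\<exists>d\<ge>1. A_cone d (dual_cone \<Sigma>))"

definition canonical_tropical_domain :: "plane set \<Rightarrow> bool" where
  "canonical_tropical_domain P \<longleftrightarrow> polygonal_domain P \<and> interior P \<noteq> {} \<and>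
     (\<forall>x. x extreme_point_of P \<longrightarrow>
        (\<exists>\<Sigma> U. canonical_angle \<Sigma> \<and> open U \<and> x \<in> U \<and> P \<inter> U = (+) x ` \<Sigma> \<inter> U))"

end

theory Submission
  imports Defs "HOL-Analysis.Kronecker_Approximation_Theorem"
begin

text \<open>
  For a point \<open>x\<close> put \<open>f(\<lambda>) = \<lambda>(x) - min\<^sub>\<Phi> \<lambda>\<close>, a convex and positively homogeneous function of the
  slope. Membership \<open>x \<in> \<Phi>(t)\<close> means \<open>f \<ge> t\<close> on all primitive \<open>\<lambda>\<close> whose minimum on \<open>\<Phi>\<close> is attained.
  If \<open>v\<close>, \<open>w\<close> are the extreme slopes active at a vertex \<open>x\<close>, so that \<open>f(v) = f(w) = t\<close>, then convexity
  gives \<open>f < t\<close> inside the triangle \<open>0\<close>, \<open>v\<close>, \<open>w\<close>; hence this triangle contains no lattice points, and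
  its cone has height 1. Local finiteness follows since \<open>\<Phi>(t)\<close> avoids the boundary of \<open>\<Phi>\<close>, where
  lattice slopes approximating a supporting normal have arbitrarily small \<open>f\<close>. Finally, a side of
  \<open>\<Phi>(t')\<close> is mapped into the parallel side of \<open>\<Phi>(t)\<close> by a homothety centred at a point of \<open>\<Phi>\<close> where
  its slope is minimal.
\<close>

section \<open>Plane and lattice algebra\<close>

text \<open>Real counterpart of \<open>wedge\<close>; supporting normals need not be lattice
  vectors.\<close>

definition cross2 :: "plane \<Rightarrow> plane \<Rightarrow> real" where
  "cross2 v w = fst v * snd w - snd v * fst w"

lemma inner_plane: "p \<bullet> q = fst p * fst q + snd p * snd q" for p q :: plane
  by (simp add: inner_prod_def)

lemma cross2_of_lattice: "cross2 (of_lattice v) (of_lattice w) = of_int (wedge v w)"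
  by (simp add: cross2_def wedge_def of_lattice_def)

text \<open>Cramer's rule without division, so that it still yields a relation when \<open>v\<close>
  and \<open>w\<close> are parallel.\<close>

lemma cramer: "cross2 v w *\<^sub>R q = cross2 q w *\<^sub>R v + cross2 v q *\<^sub>R w"
  by (simp add: cross2_def prod_eq_iff algebra_simps)

lemma cramer_div:
  assumes "cross2 v w \<noteq> 0"
  shows "q = (cross2 q w / cross2 v w) *\<^sub>R v + (cross2 v q / cross2 v w) *\<^sub>R w"
proof -
  have "q = (1 / cross2 v w) *\<^sub>R (cross2 v w *\<^sub>R q)"
    using assms by simp
  also have "\<dots> = (cross2 q w / cross2 v w) *\<^sub>R v + (cross2 v q / cross2 v w) *\<^sub>R w"
    by (subst cramer) (simp add: scaleR_add_right)
  finally show ?thesis .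
qed

lemma of_lattice_eq_0_iff: "of_lattice v = 0 \<longleftrightarrow> v = 0"
  by (auto simp: of_lattice_def zero_prod_def prod_eq_iff)

lemma of_lattice_uminus: "of_lattice (- v) = - of_lattice v"
  by (simp add: of_lattice_def)

lemma primitive_nonzero: "primitive v \<Longrightarrow> of_lattice v \<noteq> 0"
  by (auto simp: of_lattice_eq_0_iff primitive_def)

lemma multiple_of_primitive:
  assumes "u \<noteq> 0"
  obtains l g where "primitive l" "g \<ge> (1::int)" "of_lattice u = of_int g *\<^sub>R of_lattice l"
proof -
  define g where "g = gcd (fst u) (snd u)"
  have "g \<noteq> 0" using assms by (auto simp: g_def prod_eq_iff)
  then obtain a b where ab: "fst u = a * g" "snd u = b * g" "coprime a b"
    using gcd_coprime_exists[of "fst u" "snd u"] unfolding g_def by blast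
  have "g \<ge> 0" unfolding g_def by (rule gcd_ge_0_int)
  then have "g \<ge> 1" using \<open>g \<noteq> 0\<close> by linarith
  then show ?thesis
    using that[of "(a, b)" g] ab by (simp add: primitive_def of_lattice_def)
qed

text \<open>Coprimality turns the vanishing determinant into mutual divisibility of the coordinates,
  which therefore agree up to sign.\<close>

lemma parallel_primitive:
  assumes "primitive v" "primitive w" "wedge v w = 0"
  shows "w = v \<or> w = - v"
proof -
  have eq: "fst v * snd w = snd v * fst w"
    using assms(3) by (simp add: wedge_def)
  have cv: "coprime (fst v) (snd v)" and cw: "coprime (fst w) (snd w)"
    using assms by (auto simp: primitive_def)
  have "fst v dvd fst w * snd v" "fst w dvd fst v * snd w" "snd v dvd snd w * fst v" "snd w dvd snd v * fst w"
    using eq by (metis dvd_triv_left mult.commute)+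
  then have "fst v dvd fst w" "fst w dvd fst v" "snd v dvd snd w" "snd w dvd snd v"
    using cv cw by (auto simp: coprime_dvd_mult_left_iff coprime_commute)
  then have f: "fst w = fst v \<or> fst w = - fst v" and s: "snd w = snd v \<or> snd w = - snd v"
    using zdvd_antisym_abs[of "fst v" "fst w"] zdvd_antisym_abs[of "snd v" "snd w"]
    by (auto simp: abs_eq_iff)
  \<comment> \<open>Different signs in the two coordinates force one of them to vanish, where the
    sign is immaterial.\<close>
  have "snd v = 0 \<or> fst v = 0"
    if "(fst w = - fst v \<and> snd w = snd v) \<or> (fst w = fst v \<and> snd w = - snd v)"
    using that eq by auto
  then show ?thesis using f s by (auto simp: prod_eq_iff)
qed

lemma lattice_complement:
  assumes "primitive v"
  obtains m where "wedge v m = 1"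
proof -
  obtain x y where "x * fst v + y * snd v = gcd (fst v) (snd v)"
    using bezout_int by blast
  then have "wedge v (- y, x) = 1"
    using assms by (simp add: primitive_def wedge_def algebra_simps)
  then show ?thesis using that by blast
qed

text \<open>
  The lattice points \<open>u\<close> with \<open>wedge v u = 1\<close> form a line parallel to \<open>v\<close>; the one whose first
  coordinate in the basis \<open>v\<close>, \<open>w\<close> lies in \<open>[0, 1)\<close> misses the open triangle only if
  \<open>wedge v w\<close> divides \<open>w - v\<close>.
\<close>

lemma empty_triangle_imp_dvd:
  assumes "primitive v" "primitive w" and D: "wedge v w > 0"
    and empty: "\<And>u a b. \<lbrakk>of_lattice u = a *\<^sub>R of_lattice v + b *\<^sub>R of_lattice w; 0 < a; 0 < b\<rbrakk>
                  \<Longrightarrow> 1 \<le> a + b"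
  shows "wedge v w dvd fst v - fst w \<and> wedge v w dvd snd v - snd w"
proof -
  define D where "D = wedge v w"
  have "D > 0" using D by (simp add: D_def)
  obtain u0 where u0: "wedge v u0 = 1"
    using lattice_complement assms(1) by blast
  \<comment> \<open>Subtracting \<open>k\<close> copies of \<open>v\<close> keeps
    \<open>wedge v u = 1\<close> and reduces \<open>wedge u w\<close> modulo
    \<open>D\<close>.\<close>
  define k where "k = wedge u0 w div D"
  define j where "j = wedge u0 w mod D"
  define u where "u = (fst u0 - k * fst v, snd u0 - k * snd v)"
  have vu: "wedge v u = 1"
    using u0 by (simp add: u_def wedge_def algebra_simps)
  have uw: "wedge u w = j"
  proof -
    have "wedge u w = wedge u0 w - k * D"
      by (simp add: u_def wedge_def D_def algebra_simps)
    also have "\<dots> = j"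
      unfolding k_def j_def by (rule minus_div_mult_eq_mod)
    finally show ?thesis .
  qed
  have j: "0 \<le> j" "j < D" using \<open>D > 0\<close> by (auto simp: j_def)
  have u_eq: "of_lattice u = (real_of_int j / D) *\<^sub>R of_lattice v + (1 / real_of_int D) *\<^sub>R of_lattice w"
    using cramer_div[of "of_lattice v" "of_lattice w" "of_lattice u"] \<open>D > 0\<close>
    by (simp add: cross2_of_lattice vu uw flip: D_def)
  have DU: "D * fst u = j * fst v + fst w" "D * snd u = j * snd v + snd w"
  proof -
    have "real_of_int D *\<^sub>R of_lattice u = real_of_int j *\<^sub>R of_lattice v + of_lattice w"
      using \<open>D > 0\<close> by (simp add: u_eq scaleR_add_right)
    then have "real_of_int (D * fst u) = real_of_int (j * fst v + fst w)"
      "real_of_int (D * snd u) = real_of_int (j * snd v + snd w)"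
      by (simp_all add: of_lattice_def)
    then show "D * fst u = j * fst v + fst w" "D * snd u = j * snd v + snd w"
      by linarith+
  qed
  \<comment> \<open>For \<open>j = 0\<close> the primitive vector \<open>w\<close> is
    \<open>D\<close> times \<open>u\<close>, so \<open>D = 1\<close>. Otherwise both coefficients of
    \<open>u\<close> are positive and \<open>empty\<close> gives
    \<open>j + 1 \<ge> D\<close>.\<close>
  have "j = D - 1"
  proof (cases "j = 0")
    case True
    then have "fst w = D * fst u" "snd w = D * snd u"
      using DU by simp_all
    then have "D dvd fst w" "D dvd snd w" by simp_all
    then have "is_unit D"
      by (rule coprime_common_divisor[OF assms(2)[unfolded primitive_def]])
    then show ?thesis using \<open>D > 0\<close> True by simp
  next
    case False
    then have "1 \<le> real_of_int j / D + 1 / real_of_int D"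
      using empty[OF u_eq] j \<open>D > 0\<close> by simp
    then have "real_of_int D \<le> real_of_int (j + 1)"
      using \<open>D > 0\<close> by (simp add: field_simps)
    then show ?thesis using j by linarith
  qed
  then have "D * fst u = D * fst v - fst v + fst w" "D * snd u = D * snd v - snd v + snd w"
    using DU by (simp_all only: left_diff_distrib mult_1)
  then have "fst v - fst w = D * (fst v - fst u)" "snd v - snd w = D * (snd v - snd u)"
    unfolding right_diff_distrib by linarith+
  then show ?thesis unfolding D_def[symmetric] by simp
qed

text \<open>The determinant is an integer combination of the coordinates of \<open>v - w\<close>, so
  each of their common divisors divides it. Equality of width and determinant means height
  1.\<close>

lemma width_eq_wedge:
  assumes "wedge v w > 0" "wedge v w dvd fst v - fst w" "wedge v w dvd snd v - snd w"
  shows "width v w = wedge v w"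
  unfolding width_def
proof (rule Greatest_equality)
  fix l assume l: "l dvd fst v - fst w \<and> l dvd snd v - snd w"
  have "wedge v w = snd v * (fst v - fst w) - fst v * (snd v - snd w)"
    by (simp add: wedge_def algebra_simps)
  then have "l dvd wedge v w"
    using l by (simp add: dvd_diff)
  then show "l \<le> wedge v w" using assms(1) by (simp add: zdvd_imp_le)
qed (use assms in auto)

lemma canonical_angle_halfplanes:
  assumes v: "primitive v" and w: "primitive w" and D: "wedge v w > 0"
    and dvd: "wedge v w dvd fst v - fst w" "wedge v w dvd snd v - snd w"
  shows "canonical_angle {p. of_lattice v \<bullet> p \<ge> 0 \<and> of_lattice w \<bullet> p \<ge> 0}" (is "canonical_angle ?\<Sigma>")
proof -
  \<comment> \<open>Quarter turns of \<open>w\<close> and \<open>v\<close>: \<open>n1\<close> is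
    orthogonal to \<open>w\<close> and positive on \<open>v\<close>, \<open>n2\<close> the other way
    round, so they span the edges of the cone.\<close>
  define n1 n2 :: lattice where "n1 = (snd w, - fst w)" and "n2 = (- snd v, fst v)"
  define c where "c = real_of_int (wedge v w)"
  have "c > 0" using D by (simp add: c_def)
  have c: "c = cross2 (of_lattice v) (of_lattice w)"
    by (simp add: c_def cross2_of_lattice)
  have inner_n1: "q \<bullet> of_lattice n1 = cross2 q (of_lattice w)" for q
    by (simp add: n1_def of_lattice_def inner_plane cross2_def)
  have inner_n2: "q \<bullet> of_lattice n2 = cross2 (of_lattice v) q" for q
    by (simp add: n2_def of_lattice_def inner_plane cross2_def)
  have gen: "angle_generators n1 n2"
    using v w D by (auto simp: angle_generators_def primitive_def n1_def n2_def wedge_def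
        coprime_commute algebra_simps)
  have \<Sigma>: "?\<Sigma> = angle n1 n2"
  proof (intro equalityI subsetI)
    fix p assume p: "p \<in> ?\<Sigma>"
    have "c *\<^sub>R p = (of_lattice v \<bullet> p) *\<^sub>R of_lattice n1 + (of_lattice w \<bullet> p) *\<^sub>R of_lattice n2"
      by (simp add: c_def n1_def n2_def wedge_def of_lattice_def inner_plane prod_eq_iff algebra_simps)
    then have "(1 / c) *\<^sub>R c *\<^sub>R p = (of_lattice v \<bullet> p / c) *\<^sub>R of_lattice n1
        + (of_lattice w \<bullet> p / c) *\<^sub>R of_lattice n2"
      by (simp only: scaleR_add_right) simp
    then have "p = (of_lattice v \<bullet> p / c) *\<^sub>R of_lattice n1 + (of_lattice w \<bullet> p / c) *\<^sub>R of_lattice n2"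
      using \<open>c > 0\<close> by simp
    then show "p \<in> angle n1 n2"
      using p \<open>c > 0\<close> unfolding angle_def by (intro CollectI exI conjI) auto
  next
    fix p assume "p \<in> angle n1 n2"
    then show "p \<in> ?\<Sigma>"
      using \<open>c > 0\<close> by (auto simp: angle_def inner_add_right inner_n1 inner_n2 simp flip: c)
        (auto simp: cross2_def)
  qed
  have dual: "dual_cone ?\<Sigma> = angle v w"
  proof (intro equalityI subsetI)
    fix q assume q: "q \<in> dual_cone ?\<Sigma>"
    \<comment> \<open>Testing \<open>q\<close> on the two edges shows that its Cramer coefficients
      are nonnegative.\<close>
    have "of_lattice n1 \<in> ?\<Sigma>" "of_lattice n2 \<in> ?\<Sigma>"
      using \<open>c > 0\<close> by (auto simp: inner_n1 inner_n2 simp flip: c) (auto simp: cross2_def)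
    then have "cross2 q (of_lattice w) \<ge> 0" "cross2 (of_lattice v) q \<ge> 0"
      using q unfolding dual_cone_def inner_n1[symmetric] inner_n2[symmetric] by blast+
    then show "q \<in> angle v w"
      using cramer_div[of "of_lattice v" "of_lattice w" q] \<open>c > 0\<close>
      unfolding angle_def c[symmetric]
      by (intro CollectI exI[of _ "cross2 q (of_lattice w) / c"]
          exI[of _ "cross2 (of_lattice v) q / c"]) auto
  next
    fix q assume "q \<in> angle v w"
    then show "q \<in> dual_cone ?\<Sigma>"
      by (auto simp: angle_def dual_cone_def inner_add_left)
  qed
  have "A_cone (nat (wedge v w)) (angle v w)"
    unfolding A_cone_def
    using v w D by (intro exI[of _ v] exI[of _ w])
      (auto simp: angle_generators_def height_def determinant_def width_eq_wedge[OF D dvd])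
  moreover have "nat (wedge v w) \<ge> 1" using D by simp
  ultimately have "\<exists>d\<ge>1. A_cone d (dual_cone ?\<Sigma>)"
    unfolding dual by blast
  moreover have "\<exists>v w. angle_generators v w \<and> ?\<Sigma> = angle v w"
    by (intro exI conjI) (rule gen, rule \<Sigma>)
  ultimately show ?thesis
    unfolding canonical_angle_def by (rule conjI[rotated])
qed

text \<open>
  In a lattice basis \<open>l\<close>, \<open>m\<close> with \<open>\<nu> = x l + y m\<close>, the lattice point \<open>i l + j m\<close> equals
  \<open>(j / y) \<nu> + (i - j x / y) l\<close>. Multiples of the irrational number \<open>x / y\<close> by integers of a given
  sign come arbitrarily close to an integer from a given side.
\<close>

lemma lattice_point_in_half_strip:
  assumes l: "primitive l" and irr: "\<And>u r. \<nu> \<noteq> r *\<^sub>R of_lattice u" and "\<beta> > 0"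
  obtains u a b where "of_lattice u = a *\<^sub>R \<nu> + b *\<^sub>R of_lattice l" "a > 0" "0 < b" "b < \<beta>"
proof -
  obtain m where m: "wedge l m = 1" using lattice_complement[OF l] .
  define x where "x = cross2 \<nu> (of_lattice m)"
  define y where "y = cross2 (of_lattice l) \<nu>"
  have \<nu>: "\<nu> = x *\<^sub>R of_lattice l + y *\<^sub>R of_lattice m"
    using cramer_div[of "of_lattice l" "of_lattice m" \<nu>] m
    by (simp add: cross2_of_lattice x_def y_def)
  have "y \<noteq> 0"
    using irr[of x l] \<nu> by auto
  \<comment> \<open>This sign makes the coefficient of \<nu> positive for every
    \<open>k > 0\<close>.\<close>
  define \<sigma> :: int where "\<sigma> = (if y > 0 then 1 else - 1)"
  have \<sigma>: "real_of_int \<sigma> / y > 0" using \<open>y \<noteq> 0\<close> by (auto simp: \<sigma>_def)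
  define \<theta> where "\<theta> = of_int \<sigma> * (x / y)"
  have "\<theta> \<notin> \<rat>"
  proof
    assume "\<theta> \<in> \<rat>"
    then obtain r s where rs: "s > 0" "\<theta> = of_int r / of_int s"
      by (elim Rats_cases')
    have "x = y * of_int (\<sigma> * r) / of_int s"
      using rs(2) \<open>y \<noteq> 0\<close> by (auto simp: \<theta>_def \<sigma>_def field_simps split: if_splits)
    then have "\<nu> = (y / of_int s) *\<^sub>R of_lattice (\<sigma> * r * fst l + s * fst m, \<sigma> * r * snd l + s * snd m)"
      using rs(1) by (simp add: \<nu> of_lattice_def prod_eq_iff field_simps)
    then show False using irr by blast
  qed
  moreover have "\<beta> / 2 > 0" using \<open>\<beta> > 0\<close> by simp
  \<comment> \<open>Target \<open>- \<beta> / 2\<close> with tolerance \<open>\<beta> / 2\<close>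
    places \<open>h - k \<theta>\<close> in the open interval from 0 to \<beta>.\<close>
  ultimately obtain h and k :: int
    where k: "k > 0" "\<bar>of_int k * \<theta> - of_int h - (- \<beta> / 2)\<bar> < \<beta> / 2"
    by (rule sequence_of_fractional_parts_is_dense)
  define b where "b = of_int h - of_int k * \<theta>"
  have "0 < b" "b < \<beta>" using k(2) unfolding b_def by linarith+
  define a where "a = of_int k * (of_int \<sigma> / y)"
  have "a > 0" using k(1) \<sigma> unfolding a_def by (intro mult_pos_pos) auto
  have "of_lattice (h * fst l + \<sigma> * k * fst m, h * snd l + \<sigma> * k * snd m)
      = a *\<^sub>R \<nu> + b *\<^sub>R of_lattice l"
  proof -
    have "a * x = of_int k * \<theta>" "a * y = of_int (\<sigma> * k)"
      using \<open>y \<noteq> 0\<close> by (simp_all add: a_def \<theta>_def)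
    then have "a *\<^sub>R \<nu> + b *\<^sub>R of_lattice l
        = of_int h *\<^sub>R of_lattice l + of_int (\<sigma> * k) *\<^sub>R of_lattice m"
      by (simp only: \<nu> b_def scaleR_add_right scaleR_diff_left scaleR_scaleR) simp
    then show ?thesis
      by (simp add: of_lattice_def)
  qed
  then show ?thesis using that \<open>a > 0\<close> \<open>0 < b\<close> \<open>b < \<beta>\<close> by blast
qed

section \<open>Support half-planes\<close>

lemma frontier_halfplane: "primitive l \<Longrightarrow> frontier (halfplane l c) = {p. of_lattice l \<bullet> p = c}"
  using frontier_halfspace_ge[of "of_lattice l" c] primitive_nonzero[of l]
  by (simp add: halfplane_def)

text \<open>A closed set contains its frontier, and a point of \<Phi> on the boundary line of a
  half-plane containing \<Phi> is not interior. Thus touching boundaries amount to an attained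
  minimum.\<close>

lemma support_halfplanes_iff:
  assumes "closed \<Phi>"
  shows "(l, c) \<in> support_halfplanes \<Phi> \<longleftrightarrow>
    primitive l \<and> (\<forall>q\<in>\<Phi>. c \<le> of_lattice l \<bullet> q) \<and> (\<exists>q\<in>\<Phi>. of_lattice l \<bullet> q = c)"
proof (cases "primitive l")
  case True
  have "q \<in> frontier \<Phi>" if q: "q \<in> \<Phi>" "of_lattice l \<bullet> q = c" and sub: "\<Phi> \<subseteq> halfplane l c" for q
  proof -
    have "q \<in> frontier (halfplane l c)"
      using q True by (simp add: frontier_halfplane)
    then have "q \<notin> interior \<Phi>"
      using interior_mono[OF sub] by (auto simp: frontier_def)
    then show ?thesis
      using q(1) closure_subset by (auto simp: frontier_def)
  qed
  moreover have "frontier \<Phi> \<subseteq> \<Phi>"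
    using assms by (simp add: frontier_subset_eq)
  ultimately have "frontier (halfplane l c) \<inter> frontier \<Phi> \<noteq> {} \<longleftrightarrow> (\<exists>q\<in>\<Phi>. of_lattice l \<bullet> q = c)"
    if "\<Phi> \<subseteq> halfplane l c"
    using that unfolding frontier_halfplane[OF True] by blast
  moreover have "\<Phi> \<subseteq> halfplane l c \<longleftrightarrow> (\<forall>q\<in>\<Phi>. c \<le> of_lattice l \<bullet> q)"
    by (auto simp: halfplane_def)
  ultimately show ?thesis
    unfolding support_halfplanes_def mem_Collect_eq case_prod_conv using True by blast
qed (simp add: support_halfplanes_def)

text \<open>Lower bounds for both functionals and an upper bound for their positive combination
  confine \<open>q\<close> to a parallelogram, so sublevel sets are compact. The bounds
  \<open>m1\<close>, \<open>m2\<close> need not be attained.\<close>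

lemma min_attained:
  fixes v w :: plane
  assumes "closed \<Phi>" "\<Phi> \<noteq> {}" and vw: "cross2 v w \<noteq> 0" and ab: "a > 0" "b > 0"
    and lb: "\<And>q. q \<in> \<Phi> \<Longrightarrow> m1 \<le> v \<bullet> q" "\<And>q. q \<in> \<Phi> \<Longrightarrow> m2 \<le> w \<bullet> q"
  obtains q where "q \<in> \<Phi>" "\<And>q'. q' \<in> \<Phi> \<Longrightarrow> (a *\<^sub>R v + b *\<^sub>R w) \<bullet> q \<le> (a *\<^sub>R v + b *\<^sub>R w) \<bullet> q'"
proof -
  define u where "u = a *\<^sub>R v + b *\<^sub>R w"
  have u: "u \<bullet> q = a * (v \<bullet> q) + b * (w \<bullet> q)" for q
    by (simp add: u_def inner_add_left)
  obtain q1 where q1: "q1 \<in> \<Phi>" using assms(2) by blast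
  define K where "K = \<Phi> \<inter> {q. u \<bullet> q \<le> u \<bullet> q1}"
  \<comment> \<open>Inverse of the linear map sending \<open>q\<close> to
    \<open>(v \<bullet> q, w \<bullet> q)\<close>.\<close>
  define f :: "real \<times> real \<Rightarrow> plane" where
    "f = (\<lambda>z. (fst z / cross2 v w) *\<^sub>R (snd w, - fst w) + (snd z / cross2 v w) *\<^sub>R (- snd v, fst v))"
  define B where "B = {m1..(u \<bullet> q1 - b * m2) / a} \<times> {m2..(u \<bullet> q1 - a * m1) / b}"
  have "K \<subseteq> f ` B"
  proof
    fix q assume q: "q \<in> K"
    then have m: "m1 \<le> v \<bullet> q" "m2 \<le> w \<bullet> q" using lb by (auto simp: K_def)
    have le: "a * (v \<bullet> q) + b * (w \<bullet> q) \<le> u \<bullet> q1" using q by (simp add: K_def u)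
    have "b * m2 \<le> b * (w \<bullet> q)" "a * m1 \<le> a * (v \<bullet> q)"
      using m ab by (auto intro: mult_left_mono)
    then have "(v \<bullet> q) * a \<le> u \<bullet> q1 - b * m2" "(w \<bullet> q) * b \<le> u \<bullet> q1 - a * m1"
      using le by (simp_all add: mult.commute)
    then have "(v \<bullet> q, w \<bullet> q) \<in> B"
      using m ab by (simp add: B_def pos_le_divide_eq)
    moreover have "cross2 v w *\<^sub>R q = (v \<bullet> q) *\<^sub>R (snd w, - fst w) + (w \<bullet> q) *\<^sub>R (- snd v, fst v)"
      by (simp add: cross2_def inner_plane prod_eq_iff algebra_simps)
    then have "(1 / cross2 v w) *\<^sub>R cross2 v w *\<^sub>R q = f (v \<bullet> q, w \<bullet> q)"
      by (simp only: f_def scaleR_add_right) simp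
    then have "q = f (v \<bullet> q, w \<bullet> q)" using vw by simp
    ultimately show "q \<in> f ` B" by blast
  qed
  moreover have "compact (f ` B)"
    unfolding B_def f_def
    by (intro compact_continuous_image continuous_intros compact_Times compact_Icc) (use vw in auto)
  ultimately have "bounded K"
    using compact_imp_bounded bounded_subset by blast
  moreover have "closed K"
    unfolding K_def using assms(1) by (intro closed_Int closed_halfspace_le) auto
  ultimately have "compact K" by (simp add: compact_eq_bounded_closed)
  moreover have "K \<noteq> {}" using q1 by (auto simp: K_def)
  moreover have "continuous_on K (\<lambda>q. u \<bullet> q)" by (intro continuous_intros)
  ultimately obtain q where q: "q \<in> K" "\<And>q'. q' \<in> K \<Longrightarrow> u \<bullet> q \<le> u \<bullet> q'"
    using continuous_attains_inf[of K "\<lambda>q. u \<bullet> q"] by blast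
  have "u \<bullet> q \<le> u \<bullet> q'" if "q' \<in> \<Phi>" for q'
    using q[of] q(2)[of q'] that by (cases "q' \<in> K") (auto simp: K_def)
  then show ?thesis
    using that[of q] q(1) by (auto simp: K_def u_def)
qed

text \<open>
  The convex homogeneous function \<open>f(\<lambda>) = \<lambda>(p) - min\<^sub>\<Phi> \<lambda>\<close> measures how far \<open>p\<close> lies above the
  support line of slope \<open>\<lambda>\<close>. A lattice point in the interior of a cone on which \<open>\<Phi>\<close> is bounded below
  attains its minimum on \<open>\<Phi>\<close>, and passing to the primitive slope only decreases a positive \<open>f\<close>.
\<close>

lemma support_halfplane_from_lattice_point:
  assumes \<Phi>: "closed \<Phi>" "\<Phi> \<noteq> {}" and vw: "cross2 v w \<noteq> 0" and ab: "a > 0" "b > 0"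
    and lb: "\<And>q. q \<in> \<Phi> \<Longrightarrow> m1 \<le> v \<bullet> q" "\<And>q. q \<in> \<Phi> \<Longrightarrow> m2 \<le> w \<bullet> q"
    and u: "of_lattice u = a *\<^sub>R v + b *\<^sub>R w"
    and less: "a * (v \<bullet> p - m1) + b * (w \<bullet> p - m2) < t" and "t > 0"
  obtains l c where "(l, c) \<in> support_halfplanes \<Phi>" "of_lattice l \<bullet> p < c + t"
proof -
  obtain q where q: "q \<in> \<Phi>" "\<And>q'. q' \<in> \<Phi> \<Longrightarrow> of_lattice u \<bullet> q \<le> of_lattice u \<bullet> q'"
    unfolding u using min_attained[OF \<Phi> vw ab] lb by blast
  have "u \<noteq> 0"
  proof
    assume "u = 0"
    then have "a *\<^sub>R v + b *\<^sub>R w = 0" using u by (simp add: of_lattice_def zero_prod_def)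
    then have "a * fst v + b * fst w = 0" "a * snd v + b * snd w = 0"
      by (auto simp: prod_eq_iff)
    then have "a * cross2 v w = 0"
      unfolding cross2_def by algebra
    then show False using vw ab by simp
  qed
  then obtain l g where l: "primitive l" "g \<ge> (1::int)" "of_lattice u = of_int g *\<^sub>R of_lattice l"
    by (rule multiple_of_primitive)
  define c where "c = of_lattice l \<bullet> q"
  have "c \<le> of_lattice l \<bullet> q'" if "q' \<in> \<Phi>" for q'
    using q(2)[OF that] l(2) by (simp add: l(3) c_def)
  then have sup: "(l, c) \<in> support_halfplanes \<Phi>"
    using l(1) q(1) by (auto simp: support_halfplanes_iff[OF \<Phi>(1)] c_def)
  \<comment> \<open>The minimum over \<Phi> is superadditive in the slope; this is the convexity of
    the height function.\<close>
  have "a * m1 + b * m2 \<le> of_lattice u \<bullet> q"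
    unfolding u inner_add_left inner_scaleR_left
    using ab lb q(1) by (intro add_mono mult_left_mono) auto
  moreover have "of_lattice u \<bullet> p = a * (v \<bullet> p) + b * (w \<bullet> p)"
    by (simp add: u inner_add_left)
  ultimately have "of_lattice u \<bullet> p - of_lattice u \<bullet> q < t"
    using less by (simp add: algebra_simps)
  then have "of_int g * (of_lattice l \<bullet> p - c) < t"
    by (simp add: l(3) c_def algebra_simps)
  also have "t \<le> of_int g * t" using l(2) \<open>t > 0\<close> by simp
  finally have "of_lattice l \<bullet> p - c < t"
    using l(2) by (simp add: mult_less_cancel_left_pos)
  then show ?thesis using that[OF sup] by simp
qed

text \<open>A point outside \<Phi> is separated from it. For \<open>p\<close> in \<Phi> one takes
  \<open>q = p\<close>, with the normal of a hyperplane containing \<Phi> if the interior is empty,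
  and a supporting normal at the relative boundary otherwise.\<close>

lemma supporting_normal:
  fixes \<Phi> :: "'a::euclidean_space set"
  assumes "closed \<Phi>" "convex \<Phi>" "\<Phi> \<noteq> {}" "p \<notin> interior \<Phi>"
  obtains \<nu> q where "\<nu> \<noteq> 0" "q \<in> \<Phi>" "\<nu> \<bullet> p \<le> \<nu> \<bullet> q" "\<And>q'. q' \<in> \<Phi> \<Longrightarrow> \<nu> \<bullet> q \<le> \<nu> \<bullet> q'"
proof (cases "p \<in> \<Phi>")
  case False
  obtain a b y where *: "y \<in> \<Phi>" "a \<bullet> p < b" "a \<bullet> y = b" "\<forall>x\<in>\<Phi>. b \<le> a \<bullet> x"
    using supporting_hyperplane_closed_point[OF assms(2,1,3) False] by blast
  show ?thesis
  proof (rule that[of a y])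
    show "a \<noteq> 0" using *(2,3) by auto
    show "a \<bullet> p \<le> a \<bullet> y" using *(2,3) by linarith
    show "a \<bullet> y \<le> a \<bullet> q'" if "q' \<in> \<Phi>" for q' unfolding *(3) using *(4) that by blast
  qed (rule *(1))
next
  case True
  show ?thesis
  proof (cases "interior \<Phi> = {}")
    case True
    then obtain a b where "a \<noteq> 0" "\<Phi> \<subseteq> {x. a \<bullet> x = b}"
      by (rule empty_interior_subset_hyperplane[OF assms(2)])
    moreover have "a \<bullet> p \<le> a \<bullet> q'" if "q' \<in> \<Phi>" for q'
    proof -
      have "a \<bullet> q' = b" "a \<bullet> p = b" using \<open>\<Phi> \<subseteq> _\<close> \<open>p \<in> \<Phi>\<close> that by blast+
      then show ?thesis by linarith
    qed
    ultimately show ?thesis by (intro that[OF _ \<open>p \<in> \<Phi>\<close> order_refl])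
  next
    case False
    then have "p \<notin> rel_interior \<Phi>"
      using assms(4) by (simp add: rel_interior_nonempty_interior)
    then show ?thesis
      by (rule supporting_hyperplane_rel_boundary[OF assms(2) \<open>p \<in> \<Phi>\<close>])
        (rule that[OF _ \<open>p \<in> \<Phi>\<close> order_refl])
  qed
qed

text \<open>
  A point outside the interior has a real supporting normal \<open>\<nu>\<close> there. An irrational \<open>\<nu>\<close> is replaced
  by a lattice point \<open>a \<nu> + b l\<close> with \<open>(l, c)\<close> any support half-plane and \<open>b\<close> small.
\<close>

lemma support_halfplane_outside_interior:
  assumes "admissible \<Phi>" "p \<notin> interior \<Phi>" "t > 0"
  obtains l c where "(l, c) \<in> support_halfplanes \<Phi>" "of_lattice l \<bullet> p < c + t"
proof -
  have \<Phi>: "closed \<Phi>" "convex \<Phi>" using assms(1) by (auto simp: admissible_def)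
  obtain l0 c0 where "(l0, c0) \<in> support_halfplanes \<Phi>"
    using assms(1) by (fastforce simp: admissible_def)
  then have l0: "primitive l0" "\<And>q. q \<in> \<Phi> \<Longrightarrow> c0 \<le> of_lattice l0 \<bullet> q" and ne: "\<Phi> \<noteq> {}"
    by (auto simp: support_halfplanes_iff[OF \<Phi>(1)])
  obtain \<nu> q where \<nu>: "\<nu> \<noteq> 0" "q \<in> \<Phi>" "\<nu> \<bullet> p \<le> \<nu> \<bullet> q" "\<And>q'. q' \<in> \<Phi> \<Longrightarrow> \<nu> \<bullet> q \<le> \<nu> \<bullet> q'"
    using supporting_normal[OF \<Phi> ne assms(2)] by blast
  show ?thesis
  proof (cases "\<exists>u r. \<nu> = r *\<^sub>R of_lattice u")
    case True
    then obtain u r where ur: "\<nu> = r *\<^sub>R of_lattice u" by blast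
    \<comment> \<open>The factor must be positive, so that the lattice vector is also minimized, not
      maximized, at \<open>q\<close>.\<close>
    obtain u' r' where ur': "\<nu> = r' *\<^sub>R of_lattice u'" "r' > 0"
    proof (cases "r > 0")
      case False
      then have "r < 0" using ur \<nu>(1) by (cases "r = 0") auto
      then show ?thesis using that[of "- r" "- u"] ur by (simp add: of_lattice_uminus)
    qed (use that ur in blast)
    then have "u' \<noteq> 0" using \<nu>(1) by (auto simp: of_lattice_def zero_prod_def)
    then obtain l g where l: "primitive l" "g \<ge> (1::int)" "of_lattice u' = of_int g *\<^sub>R of_lattice l"
      by (rule multiple_of_primitive)
    define s where "s = r' * of_int g"
    have s: "s > 0" "\<nu> = s *\<^sub>R of_lattice l" using ur' l by (auto simp: s_def)
    then have "(l, of_lattice l \<bullet> q) \<in> support_halfplanes \<Phi>"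
      using l(1) \<nu>(2,4) by (auto simp: support_halfplanes_iff[OF \<Phi>(1)])
    moreover have "of_lattice l \<bullet> p < of_lattice l \<bullet> q + t"
      using \<nu>(3) s assms(3) by simp
    ultimately show ?thesis by (rule that)
  next
    case False
    define h where "h = \<bar>of_lattice l0 \<bullet> p - c0\<bar>"
    have h: "h \<ge> 0" "of_lattice l0 \<bullet> p - c0 \<le> h" by (auto simp: h_def)
    have "\<And>u r. \<nu> \<noteq> r *\<^sub>R of_lattice u" using False by blast
    \<comment> \<open>With \<open>b\<close> below this bound, the \<open>l0\<close> term contributes
      less than \<open>t\<close>; the \<nu> term is nonpositive however large \<open>a\<close> is.
      The added 1 covers \<open>h = 0\<close>.\<close>
    moreover have "t / (h + 1) > 0" using h assms(3) by simp
    ultimately obtain u a b where u: "of_lattice u = a *\<^sub>R \<nu> + b *\<^sub>R of_lattice l0"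
        and ab: "a > 0" "0 < b" "b < t / (h + 1)"
      by (rule lattice_point_in_half_strip[OF l0(1)])
    have indep: "cross2 \<nu> (of_lattice l0) \<noteq> 0"
    proof
      assume 0: "cross2 \<nu> (of_lattice l0) = 0"
      define n where "n = of_lattice l0 \<bullet> of_lattice l0"
      have "n \<noteq> 0" using primitive_nonzero[OF l0(1)] by (simp add: n_def)
      have "n *\<^sub>R \<nu> = (\<nu> \<bullet> of_lattice l0) *\<^sub>R of_lattice l0"
      proof -
        have "n *\<^sub>R \<nu> - (\<nu> \<bullet> of_lattice l0) *\<^sub>R of_lattice l0 =
            cross2 \<nu> (of_lattice l0) *\<^sub>R (snd (of_lattice l0), - fst (of_lattice l0))"
          by (simp add: n_def cross2_def inner_plane prod_eq_iff algebra_simps)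
        then have "n *\<^sub>R \<nu> - (\<nu> \<bullet> of_lattice l0) *\<^sub>R of_lattice l0 = 0"
          unfolding 0 by (simp only: scaleR_zero_left)
        then show ?thesis by simp
      qed
      then have "(1 / n) *\<^sub>R n *\<^sub>R \<nu> = (\<nu> \<bullet> of_lattice l0 / n) *\<^sub>R of_lattice l0"
        by simp
      then have "\<nu> = (\<nu> \<bullet> of_lattice l0 / n) *\<^sub>R of_lattice l0"
        using \<open>n \<noteq> 0\<close> by simp
      then show False using False by blast
    qed
    have less: "a * (\<nu> \<bullet> p - \<nu> \<bullet> q) + b * (of_lattice l0 \<bullet> p - c0) < t"
    proof -
      have "a * (\<nu> \<bullet> p - \<nu> \<bullet> q) \<le> 0"
        using ab(1) \<nu>(3) by (simp add: mult_nonneg_nonpos)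
      moreover have "b * (of_lattice l0 \<bullet> p - c0) \<le> b * h"
        using ab(2) h(2) by (intro mult_left_mono) auto
      moreover have "b * h + b < t"
        using ab(3) h(1) by (simp add: pos_less_divide_eq distrib_left)
      ultimately show ?thesis using ab(2) by linarith
    qed
    show ?thesis
      by (rule support_halfplane_from_lattice_point
          [OF \<Phi>(1) ne indep ab(1,2) _ _ u less assms(3)]) (use \<nu>(4) l0(2) that in blast)+
  qed
qed

section \<open>Local structure of the shrunken domains\<close>

lemma admissibleD:
  assumes "admissible \<Phi>"
  shows "closed \<Phi>" "convex \<Phi>"
  using assms by (auto simp: admissible_def)

lemma mem_shrink_iff:
  "y \<in> shrink \<Phi> t \<longleftrightarrow> (\<forall>l c. (l, c) \<in> support_halfplanes \<Phi> \<longrightarrow> c + t \<le> of_lattice l \<bullet> y)"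
  by (auto simp: shrink_def halfplane_def)

lemma mem_shrinkD:
  "y \<in> shrink \<Phi> t \<Longrightarrow> (l, c) \<in> support_halfplanes \<Phi> \<Longrightarrow> c + t \<le> of_lattice l \<bullet> y"
  unfolding mem_shrink_iff by blast

lemma convex_shrink: "convex (shrink \<Phi> t)"
  unfolding shrink_def halfplane_def
  by (intro convex_INT) (auto simp: convex_halfspace_ge)

lemma closed_shrink: "closed (shrink \<Phi> t)"
  unfolding shrink_def halfplane_def
  by (intro closed_INT) (auto simp: closed_halfspace_ge)

text \<open>A disc contains finitely many lattice vectors, and the slope determines the constant as
  its minimum on \<Phi>.\<close>

lemma finite_bounded_support_halfplanes:
  assumes "closed \<Phi>"
  shows "finite {(l, c) \<in> support_halfplanes \<Phi>. norm (of_lattice l) \<le> R}" (is "finite ?F")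
proof (rule finite_imageD)
  define N where "N = \<lceil>R\<rceil>"
  have "l \<in> {- N..N} \<times> {- N..N}" if "norm (of_lattice l) \<le> R" for l
  proof -
    have "\<bar>real_of_int (fst l)\<bar> \<le> R" "\<bar>real_of_int (snd l)\<bar> \<le> R"
      using that norm_fst_le[of "real_of_int (fst l)" "real_of_int (snd l)"]
        norm_snd_le[of "real_of_int (snd l)" "real_of_int (fst l)"]
      by (auto simp: of_lattice_def)
    then have "\<bar>fst l\<bar> \<le> N" "\<bar>snd l\<bar> \<le> N"
      unfolding N_def by linarith+
    then show ?thesis by (auto simp: mem_Times_iff)
  qed
  then have "fst ` ?F \<subseteq> {- N..N} \<times> {- N..N}" by auto
  then show "finite (fst ` ?F)"
    by (rule finite_subset) simp
  have "c = c'" if "(l, c) \<in> support_halfplanes \<Phi>" "(l, c') \<in> support_halfplanes \<Phi>" for l c c'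
    using that unfolding support_halfplanes_iff[OF assms] by (metis order_antisym)
  then show "inj_on fst ?F"
    by (auto simp: inj_on_def)
qed

text \<open>
  Around an interior point the half-plane \<open>H(t)\<close> removes from \<open>H\<close> a strip of width \<open>t / \<bar>\<lambda>\<bar>\<close>,
  so only short slopes \<open>\<lambda>\<close> matter.
\<close>

lemma finitely_many_support_halfplanes_near:
  assumes "closed \<Phi>" "p \<in> interior \<Phi>"
  obtains U F where "open U" "p \<in> U" "finite F" "F \<subseteq> support_halfplanes \<Phi>"
    "\<And>l c y. \<lbrakk>(l, c) \<in> support_halfplanes \<Phi>; (l, c) \<notin> F; y \<in> U\<rbrakk> \<Longrightarrow> c + t < of_lattice l \<bullet> y"
proof -
  obtain r where r: "r > 0" "ball p r \<subseteq> \<Phi>"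
    using assms(2) by (auto simp: mem_interior)
  define F where "F = {(l, c) \<in> support_halfplanes \<Phi>. norm (of_lattice l) \<le> 2 * t / r}"
  show ?thesis
  proof (rule that[of "ball p (r / 2)" F])
    show "finite F" unfolding F_def by (rule finite_bounded_support_halfplanes[OF assms(1)])
    fix l c y
    assume lc: "(l, c) \<in> support_halfplanes \<Phi>" "(l, c) \<notin> F" and y: "y \<in> ball p (r / 2)"
    define n where "n = norm (of_lattice l)"
    have "n > 0" using lc primitive_nonzero by (auto simp: n_def support_halfplanes_iff[OF assms(1)])
    have n: "2 * t / r < n" using lc by (auto simp: F_def n_def)
    \<comment> \<open>Moving by \<open>r / 2\<close> against the slope stays inside \<Phi> and
      lowers the functional by \<open>r * n / 2\<close>, which exceeds \<open>t\<close>.\<close>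
    define z where "z = y - (r / (2 * n)) *\<^sub>R of_lattice l"
    have "dist y z = r / 2"
      using \<open>n > 0\<close> r(1) by (simp add: z_def dist_norm flip: n_def)
    then have "dist p z < r"
      using y dist_triangle[of p z y] by simp
    then have "c \<le> of_lattice l \<bullet> z"
      using r(2) lc by (auto simp: support_halfplanes_iff[OF assms(1)])
    also have "\<dots> = of_lattice l \<bullet> y - r / (2 * n) * n\<^sup>2"
      by (simp add: z_def inner_diff_right n_def power2_norm_eq_inner)
    also have "\<dots> = of_lattice l \<bullet> y - r * n / 2"
      using \<open>n > 0\<close> by (simp add: power2_eq_square)
    finally show "c + t < of_lattice l \<bullet> y"
      using n r(1) by (simp add: pos_divide_less_eq mult.commute)
  qed (use r in \<open>auto simp: F_def\<close>)
qed

text \<open>Near interior points of \<Phi> only short slopes matter; near any other point a single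
  shifted half-plane already excludes a whole neighbourhood.\<close>

lemma shrink_locally_finite:
  assumes "admissible \<Phi>" "t > 0"
  obtains U F where "open U" "p \<in> U" "finite F" "F \<subseteq> support_halfplanes \<Phi>"
    "shrink \<Phi> t \<inter> U = {y. \<forall>(l, c) \<in> F. c + t \<le> of_lattice l \<bullet> y} \<inter> U"
proof (cases "p \<in> interior \<Phi>")
  case True
  show ?thesis
  proof (rule finitely_many_support_halfplanes_near[OF admissibleD(1)[OF assms(1)] True, where t = t])
    fix U F
    assume F: "F \<subseteq> support_halfplanes \<Phi>"
      "\<And>l c y. \<lbrakk>(l, c) \<in> support_halfplanes \<Phi>; (l, c) \<notin> F; y \<in> U\<rbrakk> \<Longrightarrow> c + t < of_lattice l \<bullet> y"
    have "y \<in> shrink \<Phi> t \<longleftrightarrow> (\<forall>(l, c) \<in> F. c + t \<le> of_lattice l \<bullet> y)" if "y \<in> U" for y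
      using F(1) F(2)[OF _ _ that] by (force simp: mem_shrink_iff)
    then have "shrink \<Phi> t \<inter> U = {y. \<forall>(l, c) \<in> F. c + t \<le> of_lattice l \<bullet> y} \<inter> U"
      by blast
    moreover assume "open U" "p \<in> U" "finite F"
    ultimately show ?thesis using F(1) by (intro that)
  qed
next
  case False
  obtain l c where lc: "(l, c) \<in> support_halfplanes \<Phi>" "of_lattice l \<bullet> p < c + t"
    using support_halfplane_outside_interior[OF assms(1) False assms(2)] by blast
  show ?thesis
  proof (rule that[of "{y. of_lattice l \<bullet> y < c + t}" "{(l, c)}"])
    show "open {y. of_lattice l \<bullet> y < c + t}" by (rule open_halfspace_lt)
    show "shrink \<Phi> t \<inter> {y. of_lattice l \<bullet> y < c + t} =
        {y. \<forall>(l, c) \<in> {(l, c)}. c + t \<le> of_lattice l \<bullet> y} \<inter> {y. of_lattice l \<bullet> y < c + t}"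
    proof -
      have "y \<notin> shrink \<Phi> t" if "of_lattice l \<bullet> y < c + t" for y
        using mem_shrinkD[OF _ lc(1), of y t] that by linarith
      then show ?thesis by auto
    qed
  qed (use lc in simp_all)
qed

text \<open>Constraints strict at \<open>x\<close> stay strict nearby, and there are finitely many,
  so locally only the cone of active ones with apex \<open>x\<close> remains.\<close>

lemma shrink_active_halfplanes:
  assumes "admissible \<Phi>" "t > 0" "x \<in> shrink \<Phi> t"
  obtains U F where "open U" "x \<in> U" "finite F" "F \<subseteq> support_halfplanes \<Phi>"
    "\<And>l c. (l, c) \<in> F \<Longrightarrow> of_lattice l \<bullet> x = c + t"
    "shrink \<Phi> t \<inter> U = {y. \<forall>(l, c) \<in> F. 0 \<le> of_lattice l \<bullet> (y - x)} \<inter> U"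
proof -
  obtain U G where U: "open U" "x \<in> U" and G: "finite G" "G \<subseteq> support_halfplanes \<Phi>"
    and eq: "shrink \<Phi> t \<inter> U = {y. \<forall>(l, c) \<in> G. c + t \<le> of_lattice l \<bullet> y} \<inter> U"
    by (rule shrink_locally_finite[OF assms(1,2)])
  define F where "F = {(l, c) \<in> G. of_lattice l \<bullet> x = c + t}"
  define V where "V = U \<inter> (\<Inter>(l, c) \<in> G - F. {y. c + t < of_lattice l \<bullet> y})"
  have "open V"
    unfolding V_def using U(1) G(1) by (intro open_Int open_INT) (auto intro: open_halfspace_gt)
  moreover have "x \<in> V"
  proof -
    have "c + t < of_lattice l \<bullet> x" if "(l, c) \<in> G - F" for l c
      using that G(2) mem_shrinkD[OF assms(3), of l c] by (auto simp: F_def order_less_le)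
    then show ?thesis using U(2) by (auto simp: V_def)
  qed
  moreover have "finite F" "F \<subseteq> support_halfplanes \<Phi>"
    using G by (auto simp: F_def intro: finite_subset[OF _ G(1)])
  moreover have active: "\<And>l c. (l, c) \<in> F \<Longrightarrow> of_lattice l \<bullet> x = c + t"
    by (simp add: F_def)
  moreover have "shrink \<Phi> t \<inter> V = {y. \<forall>(l, c) \<in> F. 0 \<le> of_lattice l \<bullet> (y - x)} \<inter> V"
  proof -
    have "y \<in> shrink \<Phi> t \<longleftrightarrow> (\<forall>(l, c) \<in> F. 0 \<le> of_lattice l \<bullet> (y - x))" if y: "y \<in> V" for y
    proof -
      have "y \<in> U" using y by (simp add: V_def)
      then have "y \<in> shrink \<Phi> t \<longleftrightarrow> (\<forall>(l, c) \<in> G. c + t \<le> of_lattice l \<bullet> y)"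
        using eq by blast
      also have "\<dots> \<longleftrightarrow> (\<forall>(l, c) \<in> F. c + t \<le> of_lattice l \<bullet> y)"
      proof -
        have "c + t \<le> of_lattice l \<bullet> y" if "(l, c) \<in> G - F" for l c
          using y that unfolding V_def by fastforce
        moreover have "F \<subseteq> G" by (auto simp: F_def)
        ultimately show ?thesis by blast
      qed
      also have "\<dots> \<longleftrightarrow> (\<forall>(l, c) \<in> F. 0 \<le> of_lattice l \<bullet> (y - x))"
        by (intro ball_cong refl) (auto simp: inner_diff_right active)
      finally show ?thesis .
    qed
    then show ?thesis by blast
  qed
  ultimately show ?thesis by (intro that)
qed

text \<open>Compactness of the closure of \<open>B\<close> combines finitely many local descriptions
  into one.\<close>

lemma polygonal_domain_shrink:
  assumes "admissible \<Phi>" "t > 0"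
  shows "polygonal_domain (shrink \<Phi> t)"
  unfolding polygonal_domain_def
proof (intro conjI allI impI)
  fix B :: "plane set" assume "bounded B"
  define good where "good = (\<lambda>p U F. open U \<and> p \<in> U \<and> finite F \<and> F \<subseteq> support_halfplanes \<Phi> \<and>
    shrink \<Phi> t \<inter> U = {y. \<forall>(l, c) \<in> F. c + t \<le> of_lattice l \<bullet> y} \<inter> U)"
  have "\<exists>U F. good p U F" for p
    unfolding good_def by (rule shrink_locally_finite[OF assms, of p]) (intro exI conjI)
  then obtain U F where good: "\<And>p. good p (U p) (F p)" by metis
  have "compact (closure B)" using \<open>bounded B\<close> by (simp add: compact_closure)
  moreover have "open (U p)" for p using good by (simp add: good_def)
  moreover have "closure B \<subseteq> \<Union> (U ` closure B)" using good by (auto simp: good_def)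
  ultimately obtain C where C: "C \<subseteq> closure B" "finite C" "closure B \<subseteq> \<Union> (U ` C)"
    by (rule compactE_image)
  define G where "G = (\<lambda>(l, c). (l, c + t)) ` (\<Union>p\<in>C. F p)"
  have G: "(l, c) \<in> G \<longleftrightarrow> (\<exists>p\<in>C. (l, c - t) \<in> F p)" for l c
    by (force simp: G_def image_iff)
  have "finite G" using C(2) good by (auto simp: G_def good_def)
  moreover have "primitive l" if "(l, c) \<in> G" for l c
    using that good by (auto simp: G good_def support_halfplanes_def)
  moreover have "shrink \<Phi> t \<inter> B = (\<Inter>(l, c) \<in> G. halfplane l c) \<inter> B"
  proof -
    have "y \<in> shrink \<Phi> t \<longleftrightarrow> (\<forall>l c. (l, c) \<in> G \<longrightarrow> c \<le> of_lattice l \<bullet> y)" if y: "y \<in> B" for y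
    proof
      assume *: "y \<in> shrink \<Phi> t"
      show "\<forall>l c. (l, c) \<in> G \<longrightarrow> c \<le> of_lattice l \<bullet> y"
      proof (intro allI impI)
        fix l c assume "(l, c) \<in> G"
        then have "(l, c - t) \<in> support_halfplanes \<Phi>"
          using good by (auto simp: G good_def)
        from mem_shrinkD[OF * this] show "c \<le> of_lattice l \<bullet> y" by simp
      qed
    next
      assume *: "\<forall>l c. (l, c) \<in> G \<longrightarrow> c \<le> of_lattice l \<bullet> y"
      obtain p where p: "p \<in> C" "y \<in> U p"
        using C(3) y closure_subset by blast
      have "c + t \<le> of_lattice l \<bullet> y" if "(l, c) \<in> F p" for l c
      proof -
        have "(l, c + t) \<in> G" using that p(1) by (auto simp: G)
        then show ?thesis using * by blast
      qed
      then have "y \<in> {y. \<forall>(l, c) \<in> F p. c + t \<le> of_lattice l \<bullet> y} \<inter> U p" using p(2) by auto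
      then show "y \<in> shrink \<Phi> t" using good[of p] unfolding good_def by blast
    qed
    then show ?thesis by (auto simp: halfplane_def)
  qed
  ultimately show "\<exists>G. finite G \<and> (\<forall>(l, c) \<in> G. primitive l) \<and>
      shrink \<Phi> t \<inter> B = (\<Inter>(l, c) \<in> G. halfplane l c) \<inter> B"
    by (intro exI[of _ G] conjI) auto
qed (rule convex_shrink)

section \<open>Vertices\<close>

text \<open>Strictness gives a direction, from a vertex to an interior point, on which all slopes
  active at the vertex are positive.\<close>

lemma inner_pos_on_interior:
  assumes "admissible \<Phi>" "z \<in> interior (shrink \<Phi> t)" "(l, c) \<in> support_halfplanes \<Phi>"
  shows "c + t < of_lattice l \<bullet> z"
proof -
  have "shrink \<Phi> t \<subseteq> {y. c + t \<le> of_lattice l \<bullet> y}"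
    using mem_shrinkD[OF _ assms(3)] by blast
  then have "z \<in> interior {y. c + t \<le> of_lattice l \<bullet> y}"
    using assms(2) interior_mono by blast
  moreover have "of_lattice l \<noteq> 0"
    using assms(3) primitive_nonzero by (auto simp: support_halfplanes_def)
  ultimately show ?thesis by simp
qed

text \<open>Along a direction orthogonal to all active slopes, a short segment centred at
  \<open>x\<close> would stay in \<open>P\<close>.\<close>

lemma extreme_point_normals_span:
  assumes "x extreme_point_of P" "open U" "x \<in> U" "finite A"
    and eq: "P \<inter> U = {y. \<forall>l\<in>A. 0 \<le> of_lattice l \<bullet> (y - x)} \<inter> U"
    and e: "\<And>l. l \<in> A \<Longrightarrow> of_lattice l \<bullet> e = 0"
  shows "e = 0"
proof (rule ccontr)
  assume "e \<noteq> 0"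
  obtain r where r: "r > 0" "ball x r \<subseteq> U"
    using assms(2,3) openE by blast
  define d where "d = (r / (2 * norm e)) *\<^sub>R e"
  have "d \<noteq> 0" "norm d < r" using \<open>e \<noteq> 0\<close> r(1) by (simp_all add: d_def)
  have in_P: "x + s *\<^sub>R d \<in> P" if "\<bar>s\<bar> = 1" for s
  proof -
    have "x + s *\<^sub>R d \<in> ball x r" using \<open>norm d < r\<close> that by (simp add: dist_norm)
    then have "x + s *\<^sub>R d \<in> U" using r(2) by blast
    moreover have "\<forall>l\<in>A. 0 \<le> of_lattice l \<bullet> ((x + s *\<^sub>R d) - x)"
      by (simp add: d_def e)
    ultimately show ?thesis using eq by blast
  qed
  have "x + d \<in> P" "x - d \<in> P" using in_P[of 1] in_P[of "- 1"] by simp_all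
  moreover have "x \<in> open_segment (x - d) (x + d)"
  proof -
    have "x = midpoint (x - d) (x + d)"
      by (simp add: midpoint_def prod_eq_iff)
    moreover have "x - d \<noteq> x + d" using \<open>d \<noteq> 0\<close> by (auto simp: prod_eq_iff)
    ultimately show ?thesis by (metis midpoint_in_open_segment)
  qed
  ultimately show False using assms(1) by (auto simp: extreme_point_of_def)
qed

text \<open>
  The vectors are ordered by their slope with respect to the orthogonal frame given by \<open>d\<close>.
\<close>

lemma clockwise_most:
  assumes "finite A" "A \<noteq> {}" and pos: "\<And>l. l \<in> A \<Longrightarrow> of_lattice l \<bullet> d > 0"
  obtains v where "v \<in> A" "\<And>l. l \<in> A \<Longrightarrow> wedge v l \<ge> 0"
proof -
  define \<sigma> where "\<sigma> = (\<lambda>l. cross2 d (of_lattice l) / (of_lattice l \<bullet> d))"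
  obtain v where v: "v \<in> A" "\<And>l. l \<in> A \<Longrightarrow> \<sigma> v \<le> \<sigma> l"
    using ex_is_arg_min_if_finite[OF assms(1,2), of \<sigma>] unfolding is_arg_min_linorder by blast
  have "wedge v l \<ge> 0" if "l \<in> A" for l
  proof -
    have "d \<bullet> d > 0" using pos[OF that] by (auto simp: inner_gt_zero_iff)
    have "cross2 d (of_lattice v) * (of_lattice l \<bullet> d) \<le> cross2 d (of_lattice l) * (of_lattice v \<bullet> d)"
      using v(2)[OF that] pos[OF that] pos[OF v(1)] by (simp add: \<sigma>_def divide_simps mult.commute)
    \<comment> \<open>This identity translates the comparison of slopes into the sign of the
      determinant.\<close>
    moreover have "(d \<bullet> d) * cross2 (of_lattice v) (of_lattice l) =
        cross2 d (of_lattice l) * (of_lattice v \<bullet> d) - cross2 d (of_lattice v) * (of_lattice l \<bullet> d)"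
      by (simp add: cross2_def inner_plane algebra_simps)
    ultimately have "(d \<bullet> d) * cross2 (of_lattice v) (of_lattice l) \<ge> 0" by simp
    then show ?thesis
      using \<open>d \<bullet> d > 0\<close> by (simp add: zero_le_mult_iff cross2_of_lattice)
  qed
  then show ?thesis using that v(1) by blast
qed

text \<open>Swapping the coordinates reverses orientation and reduces this to the clockwise
  case.\<close>

lemma counterclockwise_most:
  assumes "finite A" "A \<noteq> {}" and pos: "\<And>l. l \<in> A \<Longrightarrow> of_lattice l \<bullet> d > 0"
  obtains w where "w \<in> A" "\<And>l. l \<in> A \<Longrightarrow> wedge l w \<ge> 0"
proof -
  define swap :: "lattice \<Rightarrow> lattice" where "swap = (\<lambda>l. (snd l, fst l))"
  have "finite (swap ` A)" "swap ` A \<noteq> {}" using assms(1,2) by auto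
  moreover have "of_lattice l \<bullet> (snd d, fst d) > 0" if "l \<in> swap ` A" for l
    using that pos by (fastforce simp: swap_def of_lattice_def inner_plane)
  ultimately obtain w where w: "w \<in> swap ` A" "\<And>l. l \<in> swap ` A \<Longrightarrow> wedge w l \<ge> 0"
    using clockwise_most by blast
  then obtain w' where w': "w' \<in> A" "w = swap w'" by blast
  have "wedge l w' \<ge> 0" if "l \<in> A" for l
    using w(2)[of "swap l"] that by (simp add: w'(2) swap_def wedge_def mult.commute)
  then show ?thesis using that w'(1) by blast
qed

text \<open>The active slopes lie in an open half-plane, so two extreme ones, \<open>v\<close> and
  \<open>w\<close>, generate a cone containing all others and alone determine the local shape at
  \<open>x\<close>.\<close>

lemma shrink_vertex_canonical:
  assumes "admissible \<Phi>" "t > 0" "interior (shrink \<Phi> t) \<noteq> {}" "x extreme_point_of shrink \<Phi> t"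
  obtains \<Sigma> U where "canonical_angle \<Sigma>" "open U" "x \<in> U" "shrink \<Phi> t \<inter> U = (+) x ` \<Sigma> \<inter> U"
proof -
  have cl: "closed \<Phi>" using assms(1) by (rule admissibleD)
  have x: "x \<in> shrink \<Phi> t" using assms(4) by (simp add: extreme_point_of_def)
  obtain U F where U: "open U" "x \<in> U" and F: "finite F" "F \<subseteq> support_halfplanes \<Phi>"
    and active: "\<And>l c. (l, c) \<in> F \<Longrightarrow> of_lattice l \<bullet> x = c + t"
    and eq: "shrink \<Phi> t \<inter> U = {y. \<forall>(l, c) \<in> F. 0 \<le> of_lattice l \<bullet> (y - x)} \<inter> U"
    by (rule shrink_active_halfplanes[OF assms(1,2) x]) (rule that)
  define A where "A = fst ` F"
  have "finite A" using F(1) by (simp add: A_def)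
  have eqA: "shrink \<Phi> t \<inter> U = {y. \<forall>l\<in>A. 0 \<le> of_lattice l \<bullet> (y - x)} \<inter> U"
    unfolding eq A_def by (simp add: split_def)
  have span: "e = 0" if "\<And>l. l \<in> A \<Longrightarrow> of_lattice l \<bullet> e = 0" for e
    using extreme_point_normals_span[OF assms(4) U \<open>finite A\<close> eqA that] .
  have A: "\<exists>c. (l, c) \<in> support_halfplanes \<Phi> \<and> of_lattice l \<bullet> x = c + t" if l: "l \<in> A" for l
  proof -
    obtain c where "(l, c) \<in> F" using l by (auto simp: A_def)
    then show ?thesis using active F(2) by blast
  qed
  have prim: "primitive l" if "l \<in> A" for l
    using A[OF that] by (auto simp: support_halfplanes_def)
  obtain z where z: "z \<in> interior (shrink \<Phi> t)" using assms(3) by blast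
  have pos: "of_lattice l \<bullet> (z - x) > 0" if l: "l \<in> A" for l
  proof -
    obtain c where c: "(l, c) \<in> support_halfplanes \<Phi>" "of_lattice l \<bullet> x = c + t"
      using A[OF l] by blast
    from inner_pos_on_interior[OF assms(1) z c(1)] show ?thesis
      by (simp add: inner_diff_right c(2))
  qed
  have "A \<noteq> {}"
  proof
    assume "A = {}"
    then have "(1, 0) = (0 :: plane)" by (intro span) simp
    then show False by (simp add: zero_prod_def)
  qed
  obtain v where v: "v \<in> A" "\<And>l. l \<in> A \<Longrightarrow> wedge v l \<ge> 0"
    using clockwise_most[OF \<open>finite A\<close> \<open>A \<noteq> {}\<close> pos] by blast
  obtain w where w: "w \<in> A" "\<And>l. l \<in> A \<Longrightarrow> wedge l w \<ge> 0"
    using counterclockwise_most[OF \<open>finite A\<close> \<open>A \<noteq> {}\<close> pos] by blast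
  have cramer_wedge: "of_int (wedge v w) *\<^sub>R of_lattice l =
      of_int (wedge l w) *\<^sub>R of_lattice v + of_int (wedge v l) *\<^sub>R of_lattice w" for l
    using cramer[of "of_lattice v" "of_lattice w" "of_lattice l"] by (simp only: cross2_of_lattice)
  \<comment> \<open>Otherwise Cramer's relation evaluated on \<open>z - x\<close> makes every active
    slope equal to \<open>v\<close>, and a quarter turn of \<open>v\<close> contradicts
    \<open>span\<close>.\<close>
  have "wedge v w \<noteq> 0"
  proof
    assume 0: "wedge v w = 0"
    have "l = v" if "l \<in> A" for l
    proof -
      have "0 = of_int (wedge l w) * (of_lattice v \<bullet> (z - x)) + of_int (wedge v l) * (of_lattice w \<bullet> (z - x))"
        using arg_cong[OF cramer_wedge[of l], of "\<lambda>u. u \<bullet> (z - x)"] 0 by (simp add: inner_add_left)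
      moreover have "of_int (wedge l w) * (of_lattice v \<bullet> (z - x)) \<ge> 0"
        using w(2)[OF that] pos[OF v(1)] by simp
      moreover have "of_int (wedge v l) * (of_lattice w \<bullet> (z - x)) \<ge> 0"
        using v(2)[OF that] pos[OF w(1)] by simp
      ultimately have "of_int (wedge v l) * (of_lattice w \<bullet> (z - x)) = 0" by linarith
      then have "wedge v l = 0" using pos[OF w(1)] by simp
      then have "l = v \<or> l = - v" using parallel_primitive prim v(1) that by blast
      moreover have "l \<noteq> - v"
        using pos[OF that] pos[OF v(1)] by (auto simp: of_lattice_uminus)
      ultimately show ?thesis by blast
    qed
    then have "(- snd (of_lattice v), fst (of_lattice v)) = (0 :: plane)"
      by (intro span) (simp add: inner_plane)
    then have "of_lattice v = 0" by (simp add: prod_eq_iff)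
    then show False using primitive_nonzero prim v(1) by blast
  qed
  then have D: "wedge v w > 0" using v(2)[OF w(1)] by simp
  obtain c1 where c1: "(v, c1) \<in> support_halfplanes \<Phi>" "of_lattice v \<bullet> x = c1 + t"
    using A[OF v(1)] by blast
  obtain c2 where c2: "(w, c2) \<in> support_halfplanes \<Phi>" "of_lattice w \<bullet> x = c2 + t"
    using A[OF w(1)] by blast
  have "wedge v w dvd fst v - fst w \<and> wedge v w dvd snd v - snd w"
  proof (rule empty_triangle_imp_dvd[OF prim[OF v(1)] prim[OF w(1)] D])
    fix u a b
    assume u: "of_lattice u = a *\<^sub>R of_lattice v + b *\<^sub>R of_lattice w" and ab: "0 < a" "0 < b"
    show "1 \<le> a + b"
    proof (rule ccontr)
      assume "\<not> 1 \<le> a + b"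
      \<comment> \<open>Both \<open>v\<close> and \<open>w\<close> have height exactly
        \<open>t\<close> at \<open>x\<close>, so \<open>u\<close> would have height at most
        \<open>(a + b) * t\<close>, cutting \<open>x\<close> off from
        \<open>shrink \<Phi> t\<close>.\<close>
      then have "(a + b) * t < 1 * t" using assms(2) by (intro mult_strict_right_mono) auto
      then have less: "a * (of_lattice v \<bullet> x - c1) + b * (of_lattice w \<bullet> x - c2) < t"
        by (simp add: c1(2) c2(2) distrib_right)
      have ne: "\<Phi> \<noteq> {}" and lb: "\<And>q. q \<in> \<Phi> \<Longrightarrow> c1 \<le> of_lattice v \<bullet> q" "\<And>q. q \<in> \<Phi> \<Longrightarrow> c2 \<le> of_lattice w \<bullet> q"
        using c1(1) c2(1) by (auto simp: support_halfplanes_iff[OF cl])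
      have "cross2 (of_lattice v) (of_lattice w) \<noteq> 0" using D by (simp add: cross2_of_lattice)
      then obtain l c where "(l, c) \<in> support_halfplanes \<Phi>" "of_lattice l \<bullet> x < c + t"
        by (rule support_halfplane_from_lattice_point[OF cl ne _ ab _ _ u less assms(2)]) (use lb in blast)+
      then show False using mem_shrinkD[OF x, of l c] by simp
    qed
  qed
  then have can: "canonical_angle {p. of_lattice v \<bullet> p \<ge> 0 \<and> of_lattice w \<bullet> p \<ge> 0}"
    using canonical_angle_halfplanes[OF prim[OF v(1)] prim[OF w(1)] D] by blast
  have cone: "(\<forall>l\<in>A. 0 \<le> of_lattice l \<bullet> p) \<longleftrightarrow> of_lattice v \<bullet> p \<ge> 0 \<and> of_lattice w \<bullet> p \<ge> 0" for p
  proof (intro iffI ballI)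
    fix l assume p: "of_lattice v \<bullet> p \<ge> 0 \<and> of_lattice w \<bullet> p \<ge> 0" and l: "l \<in> A"
    have "of_int (wedge v w) * (of_lattice l \<bullet> p) =
        of_int (wedge l w) * (of_lattice v \<bullet> p) + of_int (wedge v l) * (of_lattice w \<bullet> p)"
      using arg_cong[OF cramer_wedge[of l], of "\<lambda>u. u \<bullet> p"] by (simp add: inner_add_left)
    also have "\<dots> \<ge> 0" using p v(2)[OF l] w(2)[OF l] by simp
    finally show "0 \<le> of_lattice l \<bullet> p" using D by (simp add: zero_le_mult_iff)
  qed (use v(1) w(1) in blast)
  have "shrink \<Phi> t \<inter> U = (+) x ` {p. of_lattice v \<bullet> p \<ge> 0 \<and> of_lattice w \<bullet> p \<ge> 0} \<inter> U"
  proof -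
    have "{y. y - x \<in> S} = (+) x ` S" for S :: "plane set"
    proof (intro equalityI subsetI)
      fix y assume "y \<in> {y. y - x \<in> S}"
      then have "x + (y - x) \<in> (+) x ` S" by (intro imageI) simp
      then show "y \<in> (+) x ` S" by simp
    qed auto
    from this[of "{p. of_lattice v \<bullet> p \<ge> 0 \<and> of_lattice w \<bullet> p \<ge> 0}"] show ?thesis
      unfolding eqA cone mem_Collect_eq by (rule arg_cong)
  qed
  with can U show ?thesis by (rule that)
qed

section \<open>Sides\<close>

text \<open>The face cut out by the shifted support line lies in a line and contains two distinct
  points, so its dimension is 1.\<close>

lemma mem_Fan_shrinkI:
  assumes "closed \<Phi>" and lc: "(l, c) \<in> support_halfplanes \<Phi>"
    and p: "p1 \<in> shrink \<Phi> t" "p2 \<in> shrink \<Phi> t" "p1 \<noteq> p2"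
      "of_lattice l \<bullet> p1 = c + t" "of_lattice l \<bullet> p2 = c + t"
  shows "ray l \<subseteq> Fan (shrink \<Phi> t)"
proof -
  have l: "primitive l" using lc by (simp add: support_halfplanes_def)
  define S where "S = shrink \<Phi> t \<inter> {y. of_lattice l \<bullet> y = c + t}"
  have "S face_of shrink \<Phi> t"
    unfolding S_def using mem_shrinkD[OF _ lc]
    by (intro face_of_Int_supporting_hyperplane_ge convex_shrink)
  moreover have "aff_dim S = 1"
  proof (rule antisym)
    have "aff_dim S \<le> aff_dim {y. of_lattice l \<bullet> y = c + t}"
      by (intro aff_dim_subset) (auto simp: S_def)
    then show "aff_dim S \<le> 1"
      using aff_dim_hyperplane[OF primitive_nonzero[OF l]] by simp
    have "aff_dim {p1, p2} \<le> aff_dim S"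
      using p by (intro aff_dim_subset) (auto simp: S_def)
    then show "1 \<le> aff_dim S" using p(3) by simp
  qed
  ultimately have "S edge_of shrink \<Phi> t" by (simp add: edge_of_def)
  moreover have "S \<subseteq> frontier (halfplane l (c + t))"
    by (auto simp: S_def frontier_halfplane[OF l])
  moreover have "(l, c + t) \<in> support_halfplanes (shrink \<Phi> t)"
    using l p(1,4) mem_shrinkD[OF _ lc] by (auto simp: support_halfplanes_iff[OF closed_shrink])
  ultimately show ?thesis unfolding Fan_def by blast
qed

text \<open>
  All half-planes active at the midpoint of a segment in a side are parallel to the side.
\<close>

lemma edge_shrinkD:
  assumes \<Phi>: "admissible \<Phi>" "t > 0" and sup: "(l, c) \<in> support_halfplanes (shrink \<Phi> t)"
    and S: "S edge_of shrink \<Phi> t" "S \<subseteq> frontier (halfplane l c)"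
  obtains p1 p2 where "(l, c - t) \<in> support_halfplanes \<Phi>" "p1 \<in> shrink \<Phi> t" "p2 \<in> shrink \<Phi> t" "p1 \<noteq> p2"
      "of_lattice l \<bullet> p1 = c" "of_lattice l \<bullet> p2 = c"
proof -
  have l: "primitive l" and le: "\<And>y. y \<in> shrink \<Phi> t \<Longrightarrow> c \<le> of_lattice l \<bullet> y"
    using sup by (auto simp: support_halfplanes_iff[OF closed_shrink])
  have dim: "aff_dim S = 1" using S(1) by (simp add: edge_of_def)
  then have "S \<noteq> {}" by auto
  then obtain p1 where "p1 \<in> S" by blast
  have "S \<noteq> {p1}" using dim by auto
  then obtain p2 where "p2 \<in> S" "p1 \<noteq> p2" using \<open>p1 \<in> S\<close> by blast
  then have p: "p1 \<in> shrink \<Phi> t" "p2 \<in> shrink \<Phi> t" "p1 \<noteq> p2" "of_lattice l \<bullet> p1 = c" "of_lattice l \<bullet> p2 = c"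
    using \<open>p1 \<in> S\<close> S(2) edge_of_imp_subset[OF S(1)] by (auto simp: frontier_halfplane[OF l])
  define m where "m = midpoint p1 p2"
  have "m \<in> shrink \<Phi> t"
    unfolding m_def using closed_segment_subset[OF p(1,2) convex_shrink] by auto
  have inner_m: "u \<bullet> m = (u \<bullet> p1 + u \<bullet> p2) / 2" for u
    by (simp add: m_def midpoint_def inner_add_right)
  have lm: "of_lattice l \<bullet> m = c" using p by (simp add: inner_m)
  obtain U F where U: "open U" "m \<in> U" and F: "finite F" "F \<subseteq> support_halfplanes \<Phi>"
    and active: "\<And>k c. (k, c) \<in> F \<Longrightarrow> of_lattice k \<bullet> m = c + t"
    and eq: "shrink \<Phi> t \<inter> U = {y. \<forall>(k, c) \<in> F. 0 \<le> of_lattice k \<bullet> (y - m)} \<inter> U"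
    by (rule shrink_active_halfplanes[OF \<Phi> \<open>m \<in> shrink \<Phi> t\<close>]) (rule that)
  \<comment> \<open>A constraint that is an equality at the midpoint is one at both endpoints, so
    \<open>k\<close> and \<open>l\<close> both vanish on \<open>p1 - p2\<close>.\<close>
  have parallel: "k = l \<or> k = - l" if "(k, b) \<in> F" for k b
  proof -
    have kb: "(k, b) \<in> support_halfplanes \<Phi>" using that F(2) by blast
    then have k: "primitive k" by (simp add: support_halfplanes_def)
    have "of_lattice k \<bullet> p1 + of_lattice k \<bullet> p2 = 2 * (b + t)"
      using active[OF that] by (simp add: inner_m)
    moreover have "b + t \<le> of_lattice k \<bullet> p1" "b + t \<le> of_lattice k \<bullet> p2"
      using mem_shrinkD[OF _ kb] p(1,2) by auto
    moreover have "r1 = r2" if "r1 + r2 = 2 * z" "z \<le> r1" "z \<le> r2" for r1 r2 z :: real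
      using that by linarith
    ultimately have "of_lattice k \<bullet> p1 = of_lattice k \<bullet> p2" by blast
    then have "of_lattice k \<bullet> (p1 - p2) = 0" "of_lattice l \<bullet> (p1 - p2) = 0"
      using p by (simp_all add: inner_diff_right)
    moreover have "cross2 (of_lattice l) (of_lattice k) *\<^sub>R q =
        (of_lattice l \<bullet> q) *\<^sub>R (snd (of_lattice k), - fst (of_lattice k)) +
        (of_lattice k \<bullet> q) *\<^sub>R (- snd (of_lattice l), fst (of_lattice l))" for q
      by (simp add: cross2_def inner_plane prod_eq_iff algebra_simps)
    ultimately have "cross2 (of_lattice l) (of_lattice k) *\<^sub>R (p1 - p2) = 0"
      by (simp add: zero_prod_def)
    then have "wedge l k = 0" using p(3) by (simp add: cross2_of_lattice)
    then show ?thesis using parallel_primitive[OF l k] by blast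
  qed
  \<comment> \<open>If at most \<open>- l\<close> were active, a small move from \<open>m\<close>
    against \<open>l\<close> would stay in the domain and violate its bound
    \<open>c\<close>.\<close>
  have "\<exists>b. (l, b) \<in> F"
  proof (rule ccontr)
    assume no: "\<nexists>b. (l, b) \<in> F"
    obtain r where r: "r > 0" "ball m r \<subseteq> U" using U openE by blast
    define n where "n = norm (of_lattice l)"
    have "n > 0" using primitive_nonzero[OF l] by (simp add: n_def)
    define y where "y = m - (r / (2 * n)) *\<^sub>R of_lattice l"
    have "dist m y = r / 2" using \<open>n > 0\<close> r(1) by (simp add: y_def dist_norm flip: n_def)
    then have "y \<in> U" using r by auto
    have ly: "of_lattice l \<bullet> (y - m) < 0"
      using \<open>n > 0\<close> r(1) primitive_nonzero[OF l] by (simp add: y_def)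
    have "0 \<le> of_lattice k \<bullet> (y - m)" if "(k, b) \<in> F" for k b
    proof -
      have "k = - l" using parallel[OF that] no that by blast
      then show ?thesis using ly by (simp add: of_lattice_uminus)
    qed
    then have "y \<in> shrink \<Phi> t" using eq \<open>y \<in> U\<close> by blast
    then show False using le[of y] ly lm by (simp add: inner_diff_right)
  qed
  then obtain b where b: "(l, b) \<in> F" by blast
  then have "(l, c - t) \<in> support_halfplanes \<Phi>"
    using F(2) active[OF b] lm by auto
  then show ?thesis using p by (rule that)
qed

text \<open>
  With \<open>q \<in> \<Phi>\<close> on the support line of slope \<open>l\<close>, the homothety with centre \<open>q\<close> and ratio
  \<open>t / t'\<close> maps the side of slope \<open>l\<close> of \<open>\<Phi>(t')\<close> into the one of \<open>\<Phi>(t)\<close>.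
\<close>

lemma Fan_shrink_antimono:
  assumes "admissible \<Phi>" "0 < t" "t < t'"
  shows "Fan (shrink \<Phi> t') \<subseteq> Fan (shrink \<Phi> t)"
proof
  fix x assume "x \<in> Fan (shrink \<Phi> t')"
  then obtain l c S where x: "x \<in> ray l" and lc: "(l, c) \<in> support_halfplanes (shrink \<Phi> t')"
    and S: "S edge_of shrink \<Phi> t'" "S \<subseteq> frontier (halfplane l c)"
    unfolding Fan_def by blast
  have cl: "closed \<Phi>" using assms(1) by (rule admissibleD)
  have "t' > 0" using assms by simp
  define h where "h = c - t'"
  obtain p1 p2 where lh: "(l, h) \<in> support_halfplanes \<Phi>"
    and p: "p1 \<in> shrink \<Phi> t'" "p2 \<in> shrink \<Phi> t'" "p1 \<noteq> p2" "of_lattice l \<bullet> p1 = c" "of_lattice l \<bullet> p2 = c"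
    unfolding h_def by (rule edge_shrinkD[OF assms(1) \<open>t' > 0\<close> lc S])
  obtain q where q: "q \<in> \<Phi>" "of_lattice l \<bullet> q = h"
    using lh by (auto simp: support_halfplanes_iff[OF cl])
  define s where "s = t / t'"
  have s: "0 < s" "s < 1" "s * t' = t" using assms by (auto simp: s_def)
  define H where "H = (\<lambda>p. (1 - s) *\<^sub>R q + s *\<^sub>R p)"
  have inner_H: "u \<bullet> H p = (1 - s) * (u \<bullet> q) + s * (u \<bullet> p)" for u p
    by (simp add: H_def inner_add_right)
  have H: "H p \<in> shrink \<Phi> t" if "p \<in> shrink \<Phi> t'" for p
    unfolding mem_shrink_iff
  proof (intro allI impI)
    fix k b assume kb: "(k, b) \<in> support_halfplanes \<Phi>"
    \<comment> \<open>Height at least 0 at \<open>q\<close> and at least \<open>t'\<close> at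
      \<open>p\<close> gives at least \<open>s * t' = t\<close> at \<open>H p\<close>.\<close>
    have "b \<le> of_lattice k \<bullet> q" using kb q(1) by (simp add: support_halfplanes_iff[OF cl])
    then have "(1 - s) * b + s * (b + t') \<le> of_lattice k \<bullet> H p"
      unfolding inner_H using mem_shrinkD[OF that kb] s by (intro add_mono mult_left_mono) auto
    then show "b + t \<le> of_lattice k \<bullet> H p" using s(3) by (simp add: algebra_simps)
  qed
  have "of_lattice l \<bullet> H p = h + t" if "of_lattice l \<bullet> p = c" for p
  proof -
    have "of_lattice l \<bullet> H p = (1 - s) * h + s * (h + t')"
      unfolding inner_H q(2) that by (simp add: h_def)
    also have "\<dots> = h + t" using s(3) by (simp add: algebra_simps)
    finally show ?thesis .
  qed
  moreover have "H p1 \<noteq> H p2" using p(3) s(1) by (simp add: H_def)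
  ultimately have "ray l \<subseteq> Fan (shrink \<Phi> t)"
    using p H by (intro mem_Fan_shrinkI[OF cl lh, of "H p1" t "H p2"]) auto
  then show "x \<in> Fan (shrink \<Phi> t)" using x by blast
qed

theorem theorem26:
  fixes \<Phi> :: "plane set"
  assumes "admissible \<Phi>"
  shows "(\<forall>t>0. interior (shrink \<Phi> t) \<noteq> {} \<longrightarrow> canonical_tropical_domain (shrink \<Phi> t)) \<and>
         (\<forall>t t'. 0 < t \<and> t < t' \<and> interior (shrink \<Phi> t') \<noteq> {} \<longrightarrow>
                 Fan (shrink \<Phi> t') \<subseteq> Fan (shrink \<Phi> t))"
proof (intro conjI allI impI)
  fix t :: real assume t: "t > 0" and int: "interior (shrink \<Phi> t) \<noteq> {}"
  have "\<exists>\<Sigma> U. canonical_angle \<Sigma> \<and> open U \<and> x \<in> U \<and> shrink \<Phi> t \<inter> U = (+) x ` \<Sigma> \<inter> U"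
    if "x extreme_point_of shrink \<Phi> t" for x
    by (rule shrink_vertex_canonical[OF assms t int that]) (intro exI conjI)
  then show "canonical_tropical_domain (shrink \<Phi> t)"
    unfolding canonical_tropical_domain_def
    using polygonal_domain_shrink[OF assms t] int by simp
next
  fix t t' :: real assume "0 < t \<and> t < t' \<and> interior (shrink \<Phi> t') \<noteq> {}"
  then show "Fan (shrink \<Phi> t') \<subseteq> Fan (shrink \<Phi> t)"
    using Fan_shrink_antimono[OF assms] by simp
qed

end
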